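(* Let $a<b$ be real numbers, let $r,s$ be positive continuous functions on $(a,b)$ and let $p$ be a positive integer. Then for all measurable functions $f\ge 0$ on $(a,b)$ such that all integrals below exist and are finite, $$\int_a^b r(x)\left(\int_a^x f(t)\,dt\right)^{p+1}dx\le C\int_a^b s(x)\,(f(x))^{p+1}\,dx,$$ where $$C=\sup_{a<x<b}\left(\int_x^b r(t)\,dt\right)\left(\int_a^b s^{-\frac1p}(x)\,dx\right)^p.$$
   Context: Standing assumption: all functions are measurable and all the integrals appearing in the inequality and in $C$ (including $\int_x^b r$ and $\int_a^x f$ for $x\in(a,b)$) exist and are finite. In $C$ the supremum is of $\int_x^b r(t)\,dt$ (the other factor does not depend on $x$) and is taken in $[0,+\infty]$, with $0\cdot\infty=0$. *)

theory Defs
  imports "HOL-Analysis.Analysis"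
begin

text \<open>
  The supremum is taken in \<open>[0, \<infinity>]\<close>: \<open>\<integral>\<^sub>x\<^sup>b r\<close> is finite for every \<open>x\<close> in \<open>(a,b)\<close>, but may be
  unbounded as \<open>x\<close> tends to \<open>a\<close>. Multiplication on \<^typ>\<open>ennreal\<close> satisfies \<open>0 * \<infinity> = 0\<close>.
  The Bochner integral of a non-integrable function is \<open>0\<close>, so this definition is only meaningful
  when \<open>r\<close> is integrable on every \<open>(x,b)\<close> and \<open>s powr (-1/p)\<close> is integrable on \<open>(a,b)\<close>.
\<close>

definition weight_constant :: "real \<Rightarrow> real \<Rightarrow> (real \<Rightarrow> real) \<Rightarrow> (real \<Rightarrow> real) \<Rightarrow> nat \<Rightarrow> ennreal" where
  "weight_constant a b r s p =
     (SUP x\<in>{a<..<b}. ennreal (LINT t:{x<..<b}|lebesgue. r t)) *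
     ennreal ((LINT x:{a<..<b}|lebesgue. s x powr (- 1 / real p)) ^ p)"

end

theory Submission
  imports Defs
begin

text \<open>
  Since \<open>\<integral>\<^sub>x\<^sup>b r\<close> increases to \<open>\<integral>\<^sub>a\<^sup>b r\<close> as \<open>x\<close> decreases to \<open>a\<close>, the supremum in the constant is the full
  integral of \<open>r\<close> over \<open>(a,b)\<close> (possibly infinite). It therefore suffices to bound the factor
  \<open>(\<integral>\<^sub>a\<^sup>x f)\<^sup>p\<^sup>+\<^sup>1\<close> by \<open>(\<integral>\<^sub>a\<^sup>b s\<^sup>-\<^sup>1\<^sup>/\<^sup>p)\<^sup>p \<integral>\<^sub>a\<^sup>b s f\<^sup>p\<^sup>+\<^sup>1\<close>, uniformly in \<open>x\<close>; this is Hoelder's inequality with the weight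
  \<open>w = s\<^sup>-\<^sup>1\<^sup>/\<^sup>p\<close>, obtained by integrating against \<open>w\<close> the tangent line of \<open>u \<mapsto> u\<^sup>p\<^sup>+\<^sup>1\<close> at the
  \<open>w\<close>-mean of \<open>f/w\<close>.
\<close>

text \<open>Convexity of the power, in the form of Bernoulli's inequality at
  \<open>g / c - 1 >= -1\<close>, multiplied by \<open>c ^ Suc p\<close>. Dividing by
  \<open>c\<close> forces the separate case \<open>c = 0\<close>.\<close>

lemma power_ge_tangent:
  fixes c g :: real
  assumes "0 \<le> c" "0 \<le> g"
  shows "c ^ Suc p + real (Suc p) * c ^ p * (g - c) \<le> g ^ Suc p"
proof (cases "c = 0")
  case True
  then show ?thesis using assms by (cases "p = 0") (auto simp: zero_power)
next
  case False
  then have c: "c > 0" using assms by simp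
  have "1 + real (Suc p) * (g / c - 1) \<le> (1 + (g / c - 1)) ^ Suc p"
    using assms c by (intro Bernoulli_inequality) simp
  then have "c ^ Suc p * (1 + real (Suc p) * (g / c - 1)) \<le> c ^ Suc p * (g / c) ^ Suc p"
    using c by (intro mult_left_mono) auto
  also have "c ^ Suc p * (g / c) ^ Suc p = g ^ Suc p"
    using c by (simp add: power_divide)
  also have "c ^ Suc p * (1 + real (Suc p) * (g / c - 1)) = c ^ Suc p + real (Suc p) * c ^ p * (g - c)"
    using c by (simp add: field_simps)
  finally show ?thesis .
qed

text \<open>The integrand \<open>f x ^ Suc p / w x ^ p\<close> is
  \<open>w x * (f x / w x) ^ Suc p\<close>, so after division by suitable powers of the integral of
  \<open>w\<close> this is Jensen's inequality for the measure with density
  \<open>w\<close>.\<close>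

lemma Hoelder_weighted:
  fixes f w :: "'a \<Rightarrow> real"
  assumes f: "integrable M f" "\<And>x. x \<in> space M \<Longrightarrow> 0 \<le> f x"
    and w: "integrable M w" "\<And>x. x \<in> space M \<Longrightarrow> 0 < w x"
    and fw: "integrable M (\<lambda>x. f x ^ Suc p / w x ^ p)"
  shows "(\<integral>x. f x \<partial>M) ^ Suc p \<le> (\<integral>x. w x \<partial>M) ^ p * (\<integral>x. f x ^ Suc p / w x ^ p \<partial>M)"
\<comment> \<open>The mean value used below divides by this integral. As \<open>w\<close> is
  positive, it vanishes only if \<open>M\<close> is a null measure, and then both sides are small
  enough trivially.\<close>
proof (cases "(\<integral>x. w x \<partial>M) = 0")
  case True
  then have "AE x in M. w x = 0"
    using integral_nonneg_eq_0_iff_AE[OF w(1)] w(2) by (force intro: AE_I2 less_imp_le)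
  then have "AE x in M. f x = 0"
    using AE_space by eventually_elim (use w(2) in force)
  then have "(\<integral>x. f x \<partial>M) = 0" by (rule integral_eq_zero_AE)
  moreover have "0 \<le> (\<integral>x. w x \<partial>M)"
    using w(2) by (intro integral_nonneg_AE AE_I2) (auto intro: less_imp_le)
  moreover have "0 \<le> (\<integral>x. f x ^ Suc p / w x ^ p \<partial>M)"
    using w(2) f(2) by (intro integral_nonneg_AE AE_I2) (force intro: divide_nonneg_nonneg)
  ultimately show ?thesis by simp
next
  case False
  \<comment> \<open>\<open>c\<close> is the mean of \<open>f / w\<close> with respect to the density
    \<open>w\<close>. This choice gives \<open>F - c * A = 0\<close>, so the linear term of the
    tangent disappears after integration.\<close>
  define F A B c where "F = (\<integral>x. f x \<partial>M)" and "A = (\<integral>x. w x \<partial>M)"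
    and "B = (\<integral>x. f x ^ Suc p / w x ^ p \<partial>M)" and "c = F / A"
  have "0 \<le> A" unfolding A_def
    using w(2) by (intro integral_nonneg_AE AE_I2) (auto intro: less_imp_le)
  then have A: "0 < A" using False A_def by simp
  have F: "0 \<le> F" unfolding F_def
    using f(2) by (intro integral_nonneg_AE AE_I2) auto
  have c: "0 \<le> c" using A F by (simp add: c_def)
  have "c ^ Suc p * A + real (Suc p) * c ^ p * (F - c * A)
      = (\<integral>x. c ^ Suc p * w x + real (Suc p) * c ^ p * (f x - c * w x) \<partial>M)"
    using f(1) w(1) by (simp add: F_def A_def del: of_nat_Suc)
  also have "\<dots> \<le> B"
    unfolding B_def
  proof (rule integral_mono)
    fix x assume x: "x \<in> space M"
    then have wx: "0 < w x" and fx: "0 \<le> f x" using w f by auto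
    have "w x * (c ^ Suc p + real (Suc p) * c ^ p * (f x / w x - c)) \<le> w x * (f x / w x) ^ Suc p"
      using wx fx c by (intro mult_left_mono power_ge_tangent) auto
    also have "w x * (f x / w x) ^ Suc p = f x ^ Suc p / w x ^ p"
      using wx by (simp add: field_simps)
    also have "w x * (c ^ Suc p + real (Suc p) * c ^ p * (f x / w x - c))
        = c ^ Suc p * w x + real (Suc p) * c ^ p * (f x - c * w x)"
      using wx by (simp add: field_simps)
    finally show "c ^ Suc p * w x + real (Suc p) * c ^ p * (f x - c * w x) \<le> f x ^ Suc p / w x ^ p" .
  qed (use f w fw in auto)
  finally have "c ^ Suc p * A \<le> B"
    using A by (simp add: c_def)
  \<comment> \<open>The factor \<open>A ^ p\<close> completes the left side to
    \<open>(c * A) ^ Suc p\<close>, which is \<open>F ^ Suc p\<close>.\<close>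
  then have "A ^ p * (c ^ Suc p * A) \<le> A ^ p * B"
    using A by (intro mult_left_mono) auto
  also have "A ^ p * (c ^ Suc p * A) = F ^ Suc p"
    using A by (simp add: c_def field_simps)
  finally show ?thesis by (simp add: F_def A_def B_def)
qed

text \<open>Monotone convergence along left endpoints decreasing to \<open>a\<close>. The
  nonnegative integral is used because \<open>r\<close> may fail to be integrable near
  \<open>a\<close>. Measurability on all of the interval comes from writing the function as a
  countable supremum.\<close>

lemma nn_integral_Ioo_eq_SUP:
  fixes r :: "real \<Rightarrow> real"
  assumes "a < b"
    and int: "\<And>x. x \<in> {a<..<b} \<Longrightarrow> set_integrable lebesgue {x<..<b} r"
    and pos: "\<And>x. x \<in> {a<..<b} \<Longrightarrow> 0 \<le> r x"
  shows "(\<lambda>t. ennreal (indicator {a<..<b} t * r t)) \<in> borel_measurable lebesgue" (is ?meas)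
    and "(\<integral>\<^sup>+t. ennreal (indicator {a<..<b} t * r t) \<partial>lebesgue)
      = (SUP x\<in>{a<..<b}. ennreal (LINT t:{x<..<b}|lebesgue. r t))" (is ?eq)
proof -
  \<comment> \<open>The offset 2 keeps \<open>X 0\<close> strictly below \<open>b\<close>; with
    \<open>n + 1\<close> it would equal \<open>b\<close>.\<close>
  define X where "X n = a + (b - a) / real (n + 2)" for n
  define g where "g n t = ennreal (indicator {X n<..<b} t * r t)" for n t
  have X: "X n \<in> {a<..<b}" for n
  proof -
    have "(b - a) / real (n + 2) < (b - a) / 1"
      using \<open>a < b\<close> by (intro divide_strict_left_mono) auto
    then show ?thesis using \<open>a < b\<close> by (simp add: X_def)
  qed
  have X_antimono: "X n \<le> X m" if "m \<le> n" for m n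
    unfolding X_def using that \<open>a < b\<close> by (intro add_left_mono divide_left_mono) auto
  have "(\<lambda>n. a + (b - a) / real (n + 2)) \<longlonglongrightarrow> a + 0"
    by (intro tendsto_add tendsto_const LIMSEQ_ignore_initial_segment lim_const_over_n)
  then have X_lim: "X \<longlonglongrightarrow> a"
    unfolding X_def by simp
  have X_ex: "\<exists>n. X n < t" if "a < t" for t
    using order_tendstoD(2)[OF X_lim that] by (auto simp: eventually_sequentially)
  have inc: "incseq g"
    unfolding incseq_def le_fun_def
  proof (intro allI impI)
    fix m n :: nat and t
    assume "m \<le> n"
    then have "X n \<le> X m" by (rule X_antimono)
    then show "g m t \<le> g n t"
      using X[of n] pos[of t] by (auto simp: g_def indicator_def)
  qed
  have meas_g: "g n \<in> borel_measurable lebesgue" for n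
    using int[OF X[of n]] unfolding g_def set_integrable_def by auto
  have g_SUP: "(SUP n. g n t) = ennreal (indicator {a<..<b} t * r t)" for t
  proof (cases "t \<in> {a<..<b}")
    case True
    then obtain n where n: "X n < t" using X_ex by auto
    show ?thesis
    proof (rule antisym)
      show "(SUP n. g n t) \<le> ennreal (indicator {a<..<b} t * r t)"
        using True pos by (intro SUP_least) (auto simp: g_def indicator_def)
      have "ennreal (indicator {a<..<b} t * r t) = g n t"
        using True n by (simp add: g_def)
      also have "\<dots> \<le> (SUP n. g n t)" by (rule SUP_upper) simp
      finally show "ennreal (indicator {a<..<b} t * r t) \<le> (SUP n. g n t)" .
    qed
  next
    case False
    then have "g n t = 0" for n
      using X[of n] by (auto simp: g_def indicator_def)
    then show ?thesis using False by simp
  qed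
  show ?meas
    using meas_g unfolding g_SUP[symmetric] by measurable
  have set_eq: "(\<integral>\<^sup>+t. ennreal (indicator {x<..<b} t * r t) \<partial>lebesgue)
      = ennreal (LINT t:{x<..<b}|lebesgue. r t)" if "x \<in> {a<..<b}" for x
    using int[OF that] that pos unfolding set_lebesgue_integral_def set_integrable_def
    by (subst nn_integral_eq_integral) (auto simp: indicator_def)
  have "(\<integral>\<^sup>+t. ennreal (indicator {a<..<b} t * r t) \<partial>lebesgue)
      = (SUP n. \<integral>\<^sup>+t. g n t \<partial>lebesgue)"
    unfolding g_SUP[symmetric] by (rule nn_integral_monotone_convergence_SUP[OF inc meas_g])
  \<comment> \<open>The points \<open>X n\<close> are only some of the admissible \<open>x\<close>,
    which gives one direction; the other is monotonicity of the integral in its domain.\<close>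
  also have "\<dots> \<le> (SUP x\<in>{a<..<b}. ennreal (LINT t:{x<..<b}|lebesgue. r t))"
    unfolding g_def using X by (intro SUP_least) (auto simp: set_eq intro!: SUP_upper)
  finally show ?eq
  proof (rule antisym, intro SUP_least)
    fix x assume x: "x \<in> {a<..<b}"
    show "ennreal (LINT t:{x<..<b}|lebesgue. r t)
        \<le> (\<integral>\<^sup>+t. ennreal (indicator {a<..<b} t * r t) \<partial>lebesgue)"
      unfolding set_eq[OF x, symmetric] using x pos
      by (intro nn_integral_mono ennreal_leI) (auto simp: indicator_def)
  qed
qed

theorem theorem2p14:
  fixes a b :: real and r s f :: "real \<Rightarrow> real" and p :: nat
  assumes "a < b" and "p \<ge> 1"
    and "continuous_on {a<..<b} r" and "\<And>x. x \<in> {a<..<b} \<Longrightarrow> r x > 0"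
    and "continuous_on {a<..<b} s" and "\<And>x. x \<in> {a<..<b} \<Longrightarrow> s x > 0"
    and "f \<in> borel_measurable (lebesgue_on {a<..<b})" and "\<And>x. x \<in> {a<..<b} \<Longrightarrow> f x \<ge> 0"
    and "\<And>x. x \<in> {a<..<b} \<Longrightarrow> set_integrable lebesgue {x<..<b} r"
    and "set_integrable lebesgue {a<..<b} (\<lambda>x. s x powr (- 1 / real p))"
    and "\<And>x. x \<in> {a<..<b} \<Longrightarrow> set_integrable lebesgue {a<..<x} f"
    and "set_integrable lebesgue {a<..<b} (\<lambda>x. r x * (LINT t:{a<..<x}|lebesgue. f t) ^ (p + 1))"
    and "set_integrable lebesgue {a<..<b} (\<lambda>x. s x * f x ^ (p + 1))"
  shows "ennreal (LINT x:{a<..<b}|lebesgue. r x * (LINT t:{a<..<x}|lebesgue. f t) ^ (p + 1))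
           \<le> weight_constant a b r s p * ennreal (LINT x:{a<..<b}|lebesgue. s x * f x ^ (p + 1))"
proof -
  let ?w = "\<lambda>x. s x powr (- 1 / real p)"
  note ab = assms(1) and p = assms(2) and r_pos = assms(4) and s_pos = assms(6)
    and f_nonneg = assms(8) and r_int = assms(9) and w_int = assms(10) and f_int = assms(11)
    and sf_int = assms(13)
  define A where "A = (LINT x:{a<..<b}|lebesgue. ?w x)"
  define B where "B = (LINT x:{a<..<b}|lebesgue. s x * f x ^ (p + 1))"
  define F where "F x = (LINT t:{a<..<x}|lebesgue. f t)" for x
  have lhs_int: "set_integrable lebesgue {a<..<b} (\<lambda>x. r x * F x ^ (p + 1))"
    using assms(12) by (simp only: F_def)
  have A: "0 \<le> A" unfolding A_def set_lebesgue_integral_def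
    by (intro integral_nonneg_AE AE_I2) simp
  have sf_nonneg: "0 \<le> s x * f x ^ (p + 1)" if "x \<in> {a<..<b}" for x
    using s_pos[OF that] f_nonneg[OF that] by simp
  have F: "0 \<le> F x" if "x \<in> {a<..<b}" for x
    unfolding F_def set_lebesgue_integral_def
    using that f_nonneg by (intro integral_nonneg_AE AE_I2) (simp add: indicator_def)
  have F_le: "F x ^ (p + 1) \<le> A ^ p * B" if x: "x \<in> {a<..<b}" for x
  proof -
    have sub: "{a<..<x} \<subseteq> {a<..<b}" using x by auto
    have w_int': "set_integrable lebesgue {a<..<x} ?w"
      and sf_int': "set_integrable lebesgue {a<..<x} (\<lambda>x. s x * f x ^ (p + 1))"
      using w_int sf_int sub by (auto intro: set_integrable_subset)
    \<comment> \<open>Because \<open>p\<close> is nonzero, the \<open>p\<close>-th power of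
      \<open>s powr (- 1 / real p)\<close> is \<open>1 / s\<close>, which turns the integrand of the
      weighted inequality into that of \<open>B\<close>.\<close>
    have conv: "f y ^ Suc p / ?w y ^ p = s y * f y ^ (p + 1)" if "y \<in> {a<..<x}" for y
    proof -
      have "0 < s y" using that sub s_pos by auto
      then have "?w y ^ p = s y powr (- 1)"
        using p by (subst powr_realpow[symmetric], simp, simp only: powr_powr, simp)
      also have "\<dots> = 1 / s y"
        using \<open>0 < s y\<close> by (simp add: powr_minus_divide)
      finally show ?thesis by simp
    qed
    let ?M = "lebesgue_on {a<..<x}"
    have int_conv: "integrable ?M (\<lambda>y. f y ^ Suc p / ?w y ^ p)"
      using sf_int' conv
      by (subst Bochner_Integration.integrable_cong[OF refl, where g="\<lambda>y. s y * f y ^ (p + 1)"])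
        (auto simp: integrable_restrict_space set_integrable_def)
    have "F x ^ Suc p = (\<integral>y. f y \<partial>?M) ^ Suc p"
      by (simp add: F_def integral_restrict_space set_lebesgue_integral_def)
    also have "\<dots> \<le> (\<integral>y. ?w y \<partial>?M) ^ p * (\<integral>y. f y ^ Suc p / ?w y ^ p \<partial>?M)"
    proof (rule Hoelder_weighted[OF _ _ _ _ int_conv])
      show "integrable ?M f" "integrable ?M ?w"
        using f_int[OF x] w_int' by (auto simp: integrable_restrict_space set_integrable_def)
      fix y assume "y \<in> space ?M"
      then have "y \<in> {a<..<b}" using sub by auto
      then show "0 \<le> f y" "0 < ?w y" using f_nonneg s_pos by force+
    qed
    also have "(\<integral>y. f y ^ Suc p / ?w y ^ p \<partial>?M) = (\<integral>y. s y * f y ^ (p + 1) \<partial>?M)"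
      using conv by (intro Bochner_Integration.integral_cong) auto
    \<comment> \<open>Both integrands are nonnegative, so enlarging the domain to the whole interval
      removes the dependence on \<open>x\<close>.\<close>
    also have "(\<integral>y. ?w y \<partial>?M) ^ p * \<dots> \<le> A ^ p * B"
    proof (intro mult_mono power_mono)
      show "(\<integral>y. ?w y \<partial>?M) \<le> A"
        using w_int w_int' sub unfolding A_def
        by (auto simp: integral_restrict_space set_lebesgue_integral_def set_integrable_def
            indicator_def intro!: integral_mono)
      show "(\<integral>y. s y * f y ^ (p + 1) \<partial>?M) \<le> B"
        using sf_int sf_int' sub sf_nonneg unfolding B_def
        by (auto simp: integral_restrict_space set_lebesgue_integral_def set_integrable_def
            indicator_def intro!: integral_mono)
    qed (use A sub sf_nonneg in \<open>auto intro!: integral_nonneg_AE AE_I2\<close>)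
    finally show ?thesis by simp
  qed
  have B: "0 \<le> B" unfolding B_def set_lebesgue_integral_def
    using sf_nonneg by (intro integral_nonneg_AE AE_I2) (auto simp: indicator_def)
  \<comment> \<open>From here on the integrals live in \<open>ennreal\<close>, since the integral of
    \<open>r\<close> in the upper bound may be infinite.\<close>
  have "ennreal (LINT x:{a<..<b}|lebesgue. r x * F x ^ (p + 1))
      = (\<integral>\<^sup>+x. ennreal (indicator {a<..<b} x * (r x * F x ^ (p + 1))) \<partial>lebesgue)"
    using lhs_int F r_pos unfolding set_lebesgue_integral_def set_integrable_def
    by (subst nn_integral_eq_integral) (auto simp: indicator_def less_imp_le)
  also have "\<dots> \<le> (\<integral>\<^sup>+x. ennreal (indicator {a<..<b} x * r x) * ennreal (A ^ p * B) \<partial>lebesgue)"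
  proof (intro nn_integral_mono)
    fix x
    show "ennreal (indicator {a<..<b} x * (r x * F x ^ (p + 1)))
        \<le> ennreal (indicator {a<..<b} x * r x) * ennreal (A ^ p * B)"
      using F_le[of x] r_pos[of x] A B
      by (cases "x \<in> {a<..<b}")
        (auto simp: ennreal_mult[symmetric] less_imp_le simp del: power_Suc
          intro!: ennreal_leI mult_left_mono)
  qed
  \<comment> \<open>Pulling out the constant is valid even for an infinite integral of
    \<open>r\<close>; if moreover \<open>A ^ p * B = 0\<close>, the convention that zero times
    infinity is zero applies.\<close>
  also have "\<dots> = (SUP x\<in>{a<..<b}. ennreal (LINT t:{x<..<b}|lebesgue. r t)) * ennreal (A ^ p * B)"
    using nn_integral_Ioo_eq_SUP[OF ab r_int less_imp_le[OF r_pos]]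
    by (subst nn_integral_multc) auto
  also have "\<dots> = weight_constant a b r s p * ennreal B"
    using A B by (simp add: weight_constant_def A_def ennreal_mult mult.assoc)
  finally show ?thesis by (simp only: F_def B_def)
qed

end
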